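(* Let $k$ be a field, $R=k[x_1,\ldots,x_n]$, $S=k[X_1,\ldots,X_n]$. Let $G\in S$ be a generic homogeneous form of degree $e$ and let $\prec$ be any monomial order on $R$. Then for every integer $d\in[e/2,e]$, the degree $d$ component $[\operatorname{in}(\operatorname{Ann}(G))]_d$ of the initial ideal of $\operatorname{Ann}(G)$ with respect to $\prec$ is the $k$-linear span of the first (i.e. largest with respect to $\prec$) $\dim_k R_d-\dim_k R_{e-d}$ monomials of degree $d$ of $R$.
   Context: $R$ and $S$ are standard graded polynomial rings over $k$, and $R_j$ is the degree $j$ component of $R$. $S$ is an $R$-module: in characteristic zero via differentiation, $x_i\circ g=\frac{\partial}{\partial X_i}g$; in positive characteristic via contraction, i.e. $x_i\circ X_1^{a_1}\cdots X_n^{a_n}=X_1^{a_1}\cdots X_i^{a_i-1}\cdots X_n^{a_n}$ if $a_i\ge 1$ and $0$ otherwise (extended linearly and multiplicatively). For $G\in S$, $\operatorname{Ann}(G)=\{f\in R: f\circ G=0\}$. For a homogeneous ideal $I$, $\operatorname{in}(I)$ is the ideal generated by the leading monomials of the nonzero elements of $I$. "Generic form of degree $e$" means: there is a nonzero polynomial $P$ over $k$ in the coefficients of a degree $e$ form such that the assertion holds for every $G\in S_e$ whose coefficients do not annihilate $P$ (a nonempty Zariski open condition). *)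

theory Defs
  imports Complex_Main "HOL-Library.Poly_Mapping"
begin

(* The n variables are indexed by a finite type 'n.  A monomial is its exponent vector, so that
   products of monomials are sums of exponent vectors; the library's product on
   ('n =>0 nat) =>0 'k is then the usual product of polynomials.  Both R and S are this type. *)
type_synonym 'n monom = "'n \<Rightarrow>\<^sub>0 nat"
type_synonym ('n, 'k) mpoly = "'n monom \<Rightarrow>\<^sub>0 'k"

abbreviation monom_poly :: "'n monom \<Rightarrow> ('n, 'k::zero_neq_one) mpoly" where
  "monom_poly a \<equiv> Poly_Mapping.single a 1"

definition cmul :: "'k::field \<Rightarrow> ('n, 'k) mpoly \<Rightarrow> ('n, 'k) mpoly" where
  "cmul c f = Poly_Mapping.single 0 c * f"

lemma lookup_cmul: "Poly_Mapping.lookup (cmul c f) a = c * Poly_Mapping.lookup f a"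
proof -
  have "cmul c f = Poly_Mapping.map ((*) c) f"
    by (simp add: cmul_def mult_map_scale_conv_mult)
  thus ?thesis by (simp add: map.rep_eq when_def)
qed

interpretation mpoly: vector_space "cmul :: 'k::field \<Rightarrow> ('n, 'k) mpoly \<Rightarrow> ('n, 'k) mpoly"
  by unfold_locales (auto intro!: poly_mapping_eqI simp: lookup_cmul lookup_add algebra_simps)

(* R as a module over itself: its span of a set is the ideal generated by that set. *)
abbreviation ideal_gen :: "('n, 'k::field) mpoly set \<Rightarrow> ('n, 'k) mpoly set" where
  "ideal_gen \<equiv> module.span (*)"

definition mdeg :: "'n::finite monom \<Rightarrow> nat" where
  "mdeg a = (\<Sum>i\<in>UNIV. Poly_Mapping.lookup a i)"

definition forms :: "nat \<Rightarrow> ('n::finite, 'k::field) mpoly set" where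
  "forms d = {f. \<forall>a\<in>Poly_Mapping.keys f. mdeg a = d}"

(* Differentiation in characteristic zero, contraction in positive characteristic. *)
definition var_act :: "'n \<Rightarrow> ('n, 'k::field) mpoly \<Rightarrow> ('n, 'k) mpoly" where
  "var_act i g = (\<Sum>a\<in>Poly_Mapping.keys g.
     cmul (Poly_Mapping.lookup g a)
       (if CHAR('k) = 0
        then Poly_Mapping.single (a - Poly_Mapping.single i 1) (of_nat (Poly_Mapping.lookup a i))
        else if Poly_Mapping.lookup a i \<ge> 1
        then monom_poly (a - Poly_Mapping.single i 1)
        else 0))"

(* The order of composition is irrelevant, since the var_act i commute (var_act_commute). *)
definition monom_act :: "'n::finite monom \<Rightarrow> ('n, 'k::field) mpoly \<Rightarrow> ('n, 'k) mpoly" where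
  "monom_act a g = Finite_Set.fold (\<lambda>i. var_act i ^^ Poly_Mapping.lookup a i) g UNIV"

definition act :: "('n::finite, 'k::field) mpoly \<Rightarrow> ('n, 'k) mpoly \<Rightarrow> ('n, 'k) mpoly" where
  "act f g = (\<Sum>a\<in>Poly_Mapping.keys f. cmul (Poly_Mapping.lookup f a) (monom_act a g))"

definition Ann :: "('n::finite, 'k::field) mpoly \<Rightarrow> ('n, 'k) mpoly set" where
  "Ann G = {f. act f G = 0}"

(* lt a b means that a is strictly smaller than b. *)
definition monomial_order :: "('n monom \<Rightarrow> 'n monom \<Rightarrow> bool) \<Rightarrow> bool" where
  "monomial_order lt \<longleftrightarrow> irreflp lt \<and> transp lt \<and> totalp lt \<and>
     (\<forall>a b c. lt a b \<longrightarrow> lt (a + c) (b + c)) \<and> (\<forall>a. a \<noteq> 0 \<longrightarrow> lt 0 a)"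

definition lead_monom :: "('n monom \<Rightarrow> 'n monom \<Rightarrow> bool) \<Rightarrow> ('n, 'k::field) mpoly \<Rightarrow> 'n monom" where
  "lead_monom lt f =
     (THE a. a \<in> Poly_Mapping.keys f \<and> (\<forall>b\<in>Poly_Mapping.keys f. b \<noteq> a \<longrightarrow> lt b a))"

definition initial_ideal ::
    "('n monom \<Rightarrow> 'n monom \<Rightarrow> bool) \<Rightarrow> ('n, 'k::field) mpoly set \<Rightarrow> ('n, 'k) mpoly set" where
  "initial_ideal lt I = ideal_gen {monom_poly (lead_monom lt f) | f. f \<in> I \<and> f \<noteq> 0}"

(* A monomial is among the N largest ones iff fewer than N monomials of its degree exceed it. *)
definition first_monoms ::
    "('n::finite monom \<Rightarrow> 'n monom \<Rightarrow> bool) \<Rightarrow> nat \<Rightarrow> nat \<Rightarrow> 'n monom set" where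
  "first_monoms lt d N = {a. mdeg a = d \<and> card {b. mdeg b = d \<and> lt a b} < N}"

(* A polynomial in coefficient variables, one for each monomial of S, evaluated at the
   coefficients of G. *)
definition eval_at_coeffs :: "('n monom, 'k::field) mpoly \<Rightarrow> ('n, 'k) mpoly \<Rightarrow> 'k" where
  "eval_at_coeffs P G = (\<Sum>t\<in>Poly_Mapping.keys P. Poly_Mapping.lookup P t *
     (\<Prod>a\<in>Poly_Mapping.keys t. Poly_Mapping.lookup G a ^ Poly_Mapping.lookup t a))"

(* P is required to be nonzero as a polynomial; over a finite field it may still vanish at
   every form.  The first conjunct after P \<noteq> 0 says that only the coefficient variables of
   degree e monomials occur in P. *)
definition holds_for_generic_form ::
    "nat \<Rightarrow> (('n::finite, 'k::field) mpoly \<Rightarrow> bool) \<Rightarrow> bool" where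
  "holds_for_generic_form e A \<longleftrightarrow> (\<exists>P :: ('n monom, 'k) mpoly.
     P \<noteq> 0 \<and> (\<forall>t\<in>Poly_Mapping.keys P. \<forall>a\<in>Poly_Mapping.keys t. mdeg a = e) \<and>
     (\<forall>G\<in>forms e. eval_at_coeffs P G \<noteq> 0 \<longrightarrow> A G))"

(* The remaining facts confirm that act is the intended R-module structure on S. *)

lemma lookup_var_act:
  fixes g :: "('n, 'k::field) mpoly"
  shows "Poly_Mapping.lookup (var_act i g) b =
    (if CHAR('k) = 0 then of_nat (Suc (Poly_Mapping.lookup b i)) else 1)
      * Poly_Mapping.lookup g (b + Poly_Mapping.single i 1)"
proof -
  let ?e = "Poly_Mapping.single i (1::nat)"
  let ?c = "if CHAR('k) = 0 then of_nat (Suc (Poly_Mapping.lookup b i)) else (1::'k)"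
  have shift: "a - ?e = b \<longleftrightarrow> a = b + ?e" if "Poly_Mapping.lookup a i \<ge> 1" for a
  proof
    assume "a - ?e = b"
    hence "Poly_Mapping.lookup (b + ?e) j = Poly_Mapping.lookup a j" for j
      using that by (auto simp: lookup_add lookup_minus lookup_single when_def)
    thus "a = b + ?e" by (metis poly_mapping_eqI)
  qed simp
  have "Poly_Mapping.lookup (var_act i g) b =
      (\<Sum>a\<in>Poly_Mapping.keys g. if a = b + ?e then ?c * Poly_Mapping.lookup g a else 0)"
    unfolding var_act_def lookup_sum lookup_cmul
  proof (rule sum.cong[OF refl], goal_cases)
    case (1 a)
    show ?case
    proof (cases "Poly_Mapping.lookup a i \<ge> 1")
      case True
      from shift[OF True] show ?thesis using True
        by (auto simp: lookup_single when_def lookup_add)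
    next
      case False
      hence "Poly_Mapping.lookup a i = 0" by simp
      moreover from this have "a \<noteq> b + ?e" by (auto simp: lookup_add)
      ultimately show ?thesis by simp
    qed
  qed
  also have "\<dots> = ?c * Poly_Mapping.lookup g (b + ?e)"
    by (auto simp: in_keys_iff)
  finally show ?thesis .
qed

lemma var_act_commute: "var_act i (var_act j g) = var_act j (var_act i g)"
  by (rule poly_mapping_eqI)
     (simp add: lookup_var_act lookup_add lookup_single when_def ac_simps)

lemma var_act_add: "var_act i (g + h) = var_act i g + var_act i h"
  by (rule poly_mapping_eqI) (simp add: lookup_var_act lookup_add algebra_simps)

lemma var_act_cmul: "var_act i (cmul c g) = cmul c (var_act i g)"
  by (rule poly_mapping_eqI) (simp add: lookup_var_act lookup_cmul algebra_simps)

lemma var_act_funpow_commute: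
  "(var_act i ^^ m) ((var_act j ^^ l) g) = (var_act j ^^ l) ((var_act i ^^ m) g)"
proof -
  have 1: "var_act i ((var_act j ^^ l) g) = (var_act j ^^ l) (var_act i g)" for g
    by (induction l) (simp_all add: var_act_commute[of i j])
  show ?thesis by (induction m) (simp_all add: 1)
qed

lemma comp_fun_commute_var_act:
  "comp_fun_commute (\<lambda>i. var_act i ^^ Poly_Mapping.lookup a i)"
  by standard (simp add: fun_eq_iff var_act_funpow_commute)

definition monom_act_on ::
    "'n set \<Rightarrow> 'n monom \<Rightarrow> ('n, 'k::field) mpoly \<Rightarrow> ('n, 'k) mpoly" where
  "monom_act_on I a g = Finite_Set.fold (\<lambda>i. var_act i ^^ Poly_Mapping.lookup a i) g I"

lemma monom_act_on_empty: "monom_act_on {} a g = g"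
  by (simp add: monom_act_on_def)

lemma monom_act_on_insert:
  assumes "finite I" "i \<notin> I"
  shows "monom_act_on (insert i I) a g =
    (var_act i ^^ Poly_Mapping.lookup a i) (monom_act_on I a g)"
proof -
  interpret comp_fun_commute "\<lambda>i. var_act i ^^ Poly_Mapping.lookup a i"
    by (rule comp_fun_commute_var_act)
  show ?thesis unfolding monom_act_on_def by (rule fold_insert[OF assms])
qed

lemma monom_act_on_UNIV: "monom_act a g = monom_act_on UNIV a g"
  by (simp add: monom_act_def monom_act_on_def)

lemma funpow_monom_act_on:
  "finite I \<Longrightarrow> (var_act j ^^ m) (monom_act_on I a h) = monom_act_on I a ((var_act j ^^ m) h)"
  by (induction I rule: finite_induct)
     (simp_all add: monom_act_on_empty monom_act_on_insert var_act_funpow_commute[of m j])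

lemma monom_act_add_exponent: "monom_act (a + b) g = monom_act a (monom_act b g)"
proof -
  have "monom_act_on I (a + b) g = monom_act_on I a (monom_act_on I b g)" if "finite I" for I
    using that
    by (induction I rule: finite_induct)
       (simp_all add: monom_act_on_empty monom_act_on_insert lookup_add funpow_add
          funpow_monom_act_on)
  thus ?thesis by (simp add: monom_act_on_UNIV)
qed

lemma monom_act_zero: "monom_act 0 g = g"
proof -
  have "monom_act_on I 0 g = g" if "finite I" for I
    using that
    by (induction I rule: finite_induct) (simp_all add: monom_act_on_empty monom_act_on_insert)
  thus ?thesis by (simp add: monom_act_on_UNIV)
qed

lemma monom_act_single: "monom_act (Poly_Mapping.single i 1) g = var_act i g"
proof -
  have "monom_act_on I (Poly_Mapping.single i 1) g = (if i \<in> I then var_act i g else g)"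
    if "finite I" for I
    using that
    by (induction I rule: finite_induct)
       (auto simp: monom_act_on_empty monom_act_on_insert lookup_single when_def)
  thus ?thesis by (simp add: monom_act_on_UNIV)
qed

lemma funpow_var_act_linear:
  "(var_act i ^^ m) (cmul c g + h) = cmul c ((var_act i ^^ m) g) + (var_act i ^^ m) h"
  by (induction m) (simp_all add: var_act_add var_act_cmul)

lemma monom_act_linear: "monom_act a (cmul c g + h) = cmul c (monom_act a g) + monom_act a h"
proof -
  have "monom_act_on I a (cmul c g + h) = cmul c (monom_act_on I a g) + monom_act_on I a h"
    if "finite I" for I
    using that
    by (induction I rule: finite_induct)
       (simp_all add: monom_act_on_empty monom_act_on_insert funpow_var_act_linear)
  thus ?thesis by (simp add: monom_act_on_UNIV)
qed

lemma act_superset: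
  assumes "finite A" "Poly_Mapping.keys f \<subseteq> A"
  shows "act f g = (\<Sum>a\<in>A. cmul (Poly_Mapping.lookup f a) (monom_act a g))"
  unfolding act_def using assms
  by (intro sum.mono_neutral_left) (auto simp: in_keys_iff)

lemma act_add_left: "act (f + f') g = act f g + act f' g"
proof -
  let ?A = "Poly_Mapping.keys f \<union> Poly_Mapping.keys f'"
  have "Poly_Mapping.keys (f + f') \<subseteq> ?A" by (rule keys_add)
  thus ?thesis
    by (simp add: act_superset[of ?A] lookup_add mpoly.scale_left_distrib sum.distrib)
qed

lemma act_single: "act (Poly_Mapping.single a c) g = cmul c (monom_act a g)"
  by (subst act_superset[of "{a}"]) auto

lemma act_one: "act 1 g = g"
  using act_single[of 0 1 g] by (simp add: monom_act_zero)

lemma act_linear_right: "act f (cmul c g + h) = cmul c (act f g) + act f h"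
  by (simp add: act_def monom_act_linear mpoly.scale_right_distrib sum.distrib
      mpoly.scale_sum_right mult.commute)

lemma act_sum_right: "act f (sum h A) = (\<Sum>x\<in>A. act f (h x))"
proof -
  have 0: "act f 0 = 0" using act_linear_right[of f "-1" 0 0] by simp
  show ?thesis
  proof (induction A rule: infinite_finite_induct)
    case (insert x A)
    thus ?case using act_linear_right[of f 1 "h x" "sum h A"] by simp
  qed (simp_all add: 0)
qed

lemma act_mult: "act (f * f') g = act f (act f' g)"
proof -
  have sum_left: "act (sum F A) g = (\<Sum>x\<in>A. act (F x) g)" for F :: "'c \<Rightarrow> _" and A g
    by (induction A rule: infinite_finite_induct) (simp_all add: act_add_left act_def[of 0])
  have expand: "f = (\<Sum>a\<in>Poly_Mapping.keys f. Poly_Mapping.single a (Poly_Mapping.lookup f a))"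
    for f :: "('a, 'b) mpoly"
    by (rule poly_mapping_eqI)
       (simp add: lookup_sum lookup_single when_def in_keys_iff)
  have single: "act (Poly_Mapping.single a c * Poly_Mapping.single b d) g =
      act (Poly_Mapping.single a c) (act (Poly_Mapping.single b d) g)" for a b c d
  proof -
    have "monom_act a 0 = 0" using monom_act_linear[of a 1 0 0] by simp
    hence "monom_act a (cmul d (monom_act b g)) = cmul d (monom_act a (monom_act b g))"
      using monom_act_linear[of a d "monom_act b g" 0] by simp
    thus ?thesis by (simp add: mult_single act_single monom_act_add_exponent)
  qed
  have "act (f * f') g = (\<Sum>a\<in>Poly_Mapping.keys f. \<Sum>b\<in>Poly_Mapping.keys f'.
      act (Poly_Mapping.single a (Poly_Mapping.lookup f a)
         * Poly_Mapping.single b (Poly_Mapping.lookup f' b)) g)"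
    by (subst expand[of f], subst expand[of f']) (simp add: sum_product sum_left)
  also have "\<dots> = act f (act f' g)"
  proof -
    have expand_act: "act h x = (\<Sum>a\<in>Poly_Mapping.keys h.
        act (Poly_Mapping.single a (Poly_Mapping.lookup h a)) x)" for h x :: "('a, 'b) mpoly"
      by (simp only: act_def[of h] act_single)
    show ?thesis
      by (subst expand_act[of f "act f' g"]) (simp only: expand_act[of f' g] act_sum_right single)
  qed
  finally show ?thesis .
qed

end

theory Submission
  imports Defs "HOL-Library.Countable" "Jordan_Normal_Form.Determinant"
begin

text \<open>
  The coefficient of \<open>X\<^sup>b\<close> in \<open>x\<^sup>a \<circ> G\<close> is a nonzero constant times the coefficient of \<open>G\<close> at \<open>a + b\<close>,
  so in degree \<open>d\<close> membership in \<open>Ann(G)\<close> is a linear system with a catalecticant matrix.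
  Choose any set \<open>A\<close> of \<open>dim R\<^sub>e\<^sub>-\<^sub>d\<close> monomials of degree \<open>d\<close>. In the determinant of the
  square submatrix on \<open>A\<close>, with rows and columns sorted by some monomial order, the monomial of the
  diagonal arises from no permutation but the identity, so the determinant is a nonzero polynomial
  in the coefficients of \<open>G\<close>. If it does not vanish for \<open>A\<close> the set of smallest monomials, then no
  nonzero element of \<open>Ann(G)\<close> is supported on \<open>A\<close>, whereas every larger monomial plus a suitable
  combination of \<open>A\<close> lies in \<open>Ann(G)\<close>. Taking the product of the determinants over all \<open>A\<close> and \<open>d\<close>
  makes the condition on \<open>G\<close> independent of the order.
\<close>

section \<open>Products of polynomials\<close>

lemma poly_mapping_expand:
  "f = (\<Sum>a\<in>Poly_Mapping.keys f. Poly_Mapping.single a (Poly_Mapping.lookup f a))"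
  by (rule poly_mapping_eqI) (simp add: lookup_sum lookup_single when_def in_keys_iff)

lemma mult_expand:
  fixes f g :: "'a::monoid_add \<Rightarrow>\<^sub>0 'b::semiring_0"
  shows "f * g = (\<Sum>a\<in>Poly_Mapping.keys f. \<Sum>b\<in>Poly_Mapping.keys g.
    Poly_Mapping.single (a + b) (Poly_Mapping.lookup f a * Poly_Mapping.lookup g b))"
  unfolding mult_single[symmetric] sum_product[symmetric] poly_mapping_expand[symmetric] ..

text \<open>A coefficient of a product sums over all decompositions of the exponent; here exactly
  one survives, so nothing can cancel. This serves products of leading terms and multiplication by a
  monomial alike.\<close>

lemma lookup_mult_unique:
  fixes f g :: "'a::monoid_add \<Rightarrow>\<^sub>0 'b::semiring_0"
  assumes ab: "a \<in> Poly_Mapping.keys f" "b \<in> Poly_Mapping.keys g"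
    and unique: "\<And>a' b'. a' \<in> Poly_Mapping.keys f \<Longrightarrow> b' \<in> Poly_Mapping.keys g \<Longrightarrow>
      a' + b' = a + b \<Longrightarrow> a' = a \<and> b' = b"
  shows "Poly_Mapping.lookup (f * g) (a + b) = Poly_Mapping.lookup f a * Poly_Mapping.lookup g b"
proof -
  have "Poly_Mapping.lookup (f * g) (a + b) =
      (\<Sum>a'\<in>Poly_Mapping.keys f. \<Sum>b'\<in>Poly_Mapping.keys g.
        if a' = a then if b' = b then Poly_Mapping.lookup f a * Poly_Mapping.lookup g b else 0
        else 0)"
    unfolding mult_expand lookup_sum lookup_single
    by (intro sum.cong refl) (auto simp: when_def dest: unique)
  also have "\<dots> = (\<Sum>a'\<in>Poly_Mapping.keys f.
      if a' = a then Poly_Mapping.lookup f a * Poly_Mapping.lookup g b else 0)"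
    using ab by (intro sum.cong refl) auto
  finally show ?thesis using ab by simp
qed

section \<open>Monomial orders\<close>

lemma monomial_orderD:
  assumes "monomial_order lt"
  shows "\<not> lt a a" "lt a b \<Longrightarrow> lt b c \<Longrightarrow> lt a c" "a \<noteq> b \<Longrightarrow> lt a b \<or> lt b a"
    "lt a b \<Longrightarrow> lt (a + c) (b + c)" "lt a b \<Longrightarrow> lt (c + a) (c + b)"
proof -
  have lt: "irreflp lt" "transp lt" "totalp lt" "\<And>a b c. lt a b \<Longrightarrow> lt (a + c) (b + c)"
    using assms unfolding monomial_order_def by blast+
  show "\<not> lt a a" using lt(1) by (rule irreflpD)
  show "lt a b \<Longrightarrow> lt b c \<Longrightarrow> lt a c" by (rule transpD[OF lt(2)])
  show "a \<noteq> b \<Longrightarrow> lt a b \<or> lt b a" by (rule totalpD[OF lt(3)])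
  show "lt a b \<Longrightarrow> lt (a + c) (b + c)" by (rule lt(4))
  thus "lt a b \<Longrightarrow> lt (c + a) (c + b)" by (simp add: add.commute[of c])
qed

lemma monomial_order_add_strict_mono:
  assumes lt: "monomial_order lt"
  shows "lt a a' \<Longrightarrow> lt b b' \<or> b = b' \<Longrightarrow> lt (a + b) (a' + b')"
    and "lt a a' \<or> a = a' \<Longrightarrow> lt b b' \<Longrightarrow> lt (a + b) (a' + b')"
  using monomial_orderD(2)[OF lt, of "a + b" "a' + b" "a' + b'"]
    monomial_orderD(4)[OF lt, of a a' b] monomial_orderD(5)[OF lt, of b b' a'] by auto

lemma monomial_order_max:
  assumes lt: "monomial_order lt" and "finite A" "A \<noteq> {}"
  shows "\<exists>a\<in>A. \<forall>b\<in>A. b \<noteq> a \<longrightarrow> lt b a"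
  using assms(2,3)
proof (induction A rule: finite_ne_induct)
    case (insert x A)
    then obtain a where a: "a \<in> A" "\<forall>b\<in>A. b \<noteq> a \<longrightarrow> lt b a" by blast
    show ?case
    proof (cases "lt x a")
      case True
      with a show ?thesis by blast
    next
      case False
      hence "lt a x" using monomial_orderD(3)[OF lt, of a x] a(1) insert.hyps by auto
      hence "lt b x" if "b \<in> A" for b
        using a(2) that monomial_orderD(2)[OF lt, of b a x] by (cases "b = a") auto
      thus ?thesis by blast
    qed
qed simp

text \<open>The product of the two leading terms is the only contribution at its exponent. The type
  \<open>'x\<close> of variables is not assumed finite, since the lemma is applied to polynomials in
  the coefficient variables, which are indexed by monomials.\<close>

lemma monomial_order_mult_nonzero:
  fixes f g :: "('x, 'k::field) mpoly"
  assumes lt: "monomial_order (lt :: 'x monom \<Rightarrow> _)" and "f \<noteq> 0" "g \<noteq> 0"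
  shows "f * g \<noteq> 0"
proof -
  have nonempty: "Poly_Mapping.keys f \<noteq> {}" "Poly_Mapping.keys g \<noteq> {}"
    using assms by auto
  obtain a where a: "a \<in> Poly_Mapping.keys f"
      "\<And>a'. a' \<in> Poly_Mapping.keys f \<Longrightarrow> a' \<noteq> a \<Longrightarrow> lt a' a"
    using monomial_order_max[OF lt finite_keys nonempty(1)] by blast
  obtain b where b: "b \<in> Poly_Mapping.keys g"
      "\<And>b'. b' \<in> Poly_Mapping.keys g \<Longrightarrow> b' \<noteq> b \<Longrightarrow> lt b' b"
    using monomial_order_max[OF lt finite_keys nonempty(2)] by blast
  have "a' = a \<and> b' = b" if "a' \<in> Poly_Mapping.keys f" "b' \<in> Poly_Mapping.keys g"
    "a' + b' = a + b" for a' b'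
  proof (rule ccontr)
    assume "\<not> (a' = a \<and> b' = b)"
    hence "lt a' a \<and> (lt b' b \<or> b' = b) \<or> (lt a' a \<or> a' = a) \<and> lt b' b"
      using a(2)[OF that(1)] b(2)[OF that(2)] by blast
    hence "lt (a' + b') (a + b)" using monomial_order_add_strict_mono[OF lt, of a' a b' b] by blast
    thus False using that(3) monomial_orderD(1)[OF lt] by simp
  qed
  hence "Poly_Mapping.lookup (f * g) (a + b) = Poly_Mapping.lookup f a * Poly_Mapping.lookup g b"
    by (rule lookup_mult_unique[OF a(1) b(1)])
  moreover have "Poly_Mapping.lookup f a \<noteq> 0" "Poly_Mapping.lookup g b \<noteq> 0"
    using a(1) b(1) unfolding in_keys_iff by simp_all
  ultimately have "Poly_Mapping.lookup (f * g) (a + b) \<noteq> 0"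
    by (simp only: mult_eq_0_iff simp_thms)
  thus ?thesis by (metis lookup_zero)
qed

text \<open>Renaming variables along the injection \<open>f\<close> pulls back the library's
  lexicographic order on \<open>nat monom\<close>. Variables may be infinite in number and carry no
  order of their own.\<close>

lemma ex_monomial_order:
  fixes f :: "'x \<Rightarrow> nat"
  assumes f: "inj f"
  obtains lt :: "'x monom \<Rightarrow> 'x monom \<Rightarrow> bool" where "monomial_order lt"
proof -
  define \<phi> :: "'x monom \<Rightarrow> nat monom" where
    "\<phi> a = (\<Sum>x\<in>Poly_Mapping.keys a. Poly_Mapping.single (f x) (Poly_Mapping.lookup a x))" for a
  have lookup_f: "Poly_Mapping.lookup (\<phi> a) (f x) = Poly_Mapping.lookup a x" for a x
    using f by (simp add: \<phi>_def lookup_sum lookup_single when_def inj_eq in_keys_iff)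
  have lookup_notin: "Poly_Mapping.lookup (\<phi> a) k = 0" if "k \<notin> range f" for a k
    using that by (auto simp: \<phi>_def lookup_sum lookup_single when_def intro!: sum.neutral)
  have lookup_eq: "Poly_Mapping.lookup (\<phi> a) k =
      (if k \<in> range f then Poly_Mapping.lookup a (inv_into UNIV f k) else 0)" for a k
    using lookup_f[of a] lookup_notin[of k a] f by auto
  have add: "\<phi> (a + b) = \<phi> a + \<phi> b" for a b
    by (rule poly_mapping_eqI) (simp add: lookup_eq lookup_add)
  have inj: "\<phi> a = \<phi> b \<Longrightarrow> a = b" for a b
    by (rule poly_mapping_eqI) (metis lookup_f)
  have zero: "0 < \<phi> a" if "a \<noteq> 0" for a
  proof -
    have "\<phi> 0 = 0" by (simp add: \<phi>_def)
    hence "\<phi> a \<noteq> 0" using that inj by metis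
    \<comment> \<open>The order compares values at the first index of difference, and no natural
      number lies below 0.\<close>
    moreover have "\<not> \<phi> a < 0"
      by transfer (auto simp: less_fun_def)
    ultimately show ?thesis by (metis not_less_iff_gr_or_eq)
  qed
  have "monomial_order (\<lambda>a b. \<phi> a < \<phi> b)"
    unfolding monomial_order_def
  proof (intro conjI allI impI)
    show "irreflp (\<lambda>a b. \<phi> a < \<phi> b)" by (simp add: irreflp_def)
    show "transp (\<lambda>a b. \<phi> a < \<phi> b)" by (rule transpI) (rule less_trans)
    show "totalp (\<lambda>a b. \<phi> a < \<phi> b)" using inj by (meson totalpI linorder_neqE)
  qed (simp_all add: add zero, simp add: \<phi>_def zero[unfolded \<phi>_def])
  thus ?thesis by (rule that)
qed

text \<open>Exponent vectors in finitely many variables are countable, so the coefficient variables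
  can be numbered and their monomials ordered.\<close>

lemma ex_inj_monom_nat: "\<exists>f :: 'n::finite monom \<Rightarrow> nat. inj f"
proof
  show "inj (\<lambda>a :: 'n monom. to_nat (Poly_Mapping.lookup a))"
  proof (rule injI)
    fix a b :: "'n monom"
    assume "to_nat (Poly_Mapping.lookup a) = to_nat (Poly_Mapping.lookup b)"
    hence "Poly_Mapping.lookup a = Poly_Mapping.lookup b" by (rule injD[OF inj_to_nat])
    thus "a = b" by (simp only: poly_mapping_eq_iff)
  qed
qed

text \<open>Ranks count from the top and start at 0, matching \<open>first_monoms\<close>: its
  elements are the monomials of degree \<open>d\<close> whose rank among those of that degree is
  below \<open>N\<close>.\<close>

definition rank_above :: "('a \<Rightarrow> 'a \<Rightarrow> bool) \<Rightarrow> 'a set \<Rightarrow> 'a \<Rightarrow> nat" where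
  "rank_above lt A a = card {b \<in> A. lt a b}"

lemma rank_above_less:
  assumes lt: "monomial_order lt" and "finite A" "b \<in> A" "lt a b"
  shows "rank_above lt A b < rank_above lt A a"
proof -
  have "{c \<in> A. lt b c} \<subseteq> {c \<in> A. lt a c}"
    using monomial_orderD(2)[OF lt \<open>lt a b\<close>] by auto
  moreover have "b \<in> {c \<in> A. lt a c}" "b \<notin> {c \<in> A. lt b c}"
    using assms(3,4) monomial_orderD(1)[OF lt] by auto
  ultimately have "{c \<in> A. lt b c} \<subset> {c \<in> A. lt a c}" by blast
  thus ?thesis unfolding rank_above_def using \<open>finite A\<close> by (intro psubset_card_mono) auto
qed

lemma rank_above_less_iff:
  assumes lt: "monomial_order lt" and "finite A" "a \<in> A" "b \<in> A"
  shows "rank_above lt A b < rank_above lt A a \<longleftrightarrow> lt a b"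
  using rank_above_less[OF lt assms(2), of b a] rank_above_less[OF lt assms(2), of a b]
    assms(3,4) monomial_orderD(3)[OF lt, of a b] by fastforce

text \<open>Ranks strictly decrease along \<open>lt\<close>, hence are injective; they stay below
  \<open>card A\<close> because no element counts itself. Equal cardinalities give
  surjectivity.\<close>

lemma bij_betw_rank_above:
  assumes lt: "monomial_order lt" and A: "finite A"
  shows "bij_betw (rank_above lt A) A {0..<card A}"
proof -
  have inj: "inj_on (rank_above lt A) A"
  proof (rule inj_onI, rule ccontr)
    fix a b assume "a \<in> A" "b \<in> A" "rank_above lt A a = rank_above lt A b" "a \<noteq> b"
    thus False
      using rank_above_less[OF lt A, of a b] rank_above_less[OF lt A, of b a]
        monomial_orderD(3)[OF lt, of a b] by auto
  qed
  have "rank_above lt A a < card A" if "a \<in> A" for a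
    unfolding rank_above_def using A that monomial_orderD(1)[OF lt, of a]
    by (intro psubset_card_mono) auto
  hence "rank_above lt A ` A \<subseteq> {0..<card A}" by auto
  moreover have "card (rank_above lt A ` A) = card {0..<card A}"
    using card_image[OF inj] by simp
  ultimately have "rank_above lt A ` A = {0..<card A}"
    by (intro card_subset_eq) auto
  with inj show ?thesis by (simp add: bij_betw_def)
qed

lemma ex_decreasing_enumeration:
  assumes lt: "monomial_order lt" and A: "finite A"
  obtains s where "bij_betw s {0..<card A} A" "\<And>i j. i < j \<Longrightarrow> j < card A \<Longrightarrow> lt (s j) (s i)"
proof
  let ?s = "inv_into A (rank_above lt A)"
  note bij = bij_betw_rank_above[OF lt A]
  show s: "bij_betw ?s {0..<card A} A" by (rule bij_betw_inv_into[OF bij])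
  fix i j assume ij: "i < j" "j < card A"
  have "?s i \<in> A" "?s j \<in> A" using bij_betwE[OF s] ij by auto
  moreover have "rank_above lt A (?s i) = i" "rank_above lt A (?s j) = j"
    using bij_betw_inv_into_right[OF bij] ij by auto
  ultimately show "lt (?s j) (?s i)"
    using rank_above_less_iff[OF lt A] ij(1) by metis
qed

section \<open>Polynomials in the coefficients of a form\<close>

lemma eval_at_coeffs_superset:
  assumes "finite T" "Poly_Mapping.keys P \<subseteq> T"
  shows "eval_at_coeffs P G = (\<Sum>t\<in>T. Poly_Mapping.lookup P t *
     (\<Prod>a\<in>Poly_Mapping.keys t. Poly_Mapping.lookup G a ^ Poly_Mapping.lookup t a))"
  unfolding eval_at_coeffs_def using assms
  by (intro sum.mono_neutral_left) (auto simp: in_keys_iff)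

lemma eval_at_coeffs_single:
  "eval_at_coeffs (Poly_Mapping.single t c) G =
     c * (\<Prod>a\<in>Poly_Mapping.keys t. Poly_Mapping.lookup G a ^ Poly_Mapping.lookup t a)"
  by (subst eval_at_coeffs_superset[of "{t}"]) auto

lemma eval_at_coeffs_add: "eval_at_coeffs (P + Q) G = eval_at_coeffs P G + eval_at_coeffs Q G"
proof -
  let ?T = "Poly_Mapping.keys P \<union> Poly_Mapping.keys Q"
  have "Poly_Mapping.keys (P + Q) \<subseteq> ?T" by (rule keys_add)
  thus ?thesis
    by (simp add: eval_at_coeffs_superset[of ?T] lookup_add algebra_simps sum.distrib)
qed

lemma eval_at_coeffs_sum: "eval_at_coeffs (sum F A) G = (\<Sum>x\<in>A. eval_at_coeffs (F x) G)"
  by (induction A rule: infinite_finite_induct)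
     (simp_all add: eval_at_coeffs_add eval_at_coeffs_def[of 0])

lemma prod_power_lookup_add:
  fixes h :: "'a \<Rightarrow> 'b::comm_semiring_1"
  shows "(\<Prod>a\<in>Poly_Mapping.keys (s + t). h a ^ Poly_Mapping.lookup (s + t) a) =
    (\<Prod>a\<in>Poly_Mapping.keys s. h a ^ Poly_Mapping.lookup s a) *
    (\<Prod>a\<in>Poly_Mapping.keys t. h a ^ Poly_Mapping.lookup t a)"
proof -
  let ?U = "Poly_Mapping.keys s \<union> Poly_Mapping.keys t"
  have extend: "(\<Prod>a\<in>Poly_Mapping.keys u. h a ^ Poly_Mapping.lookup u a) =
      (\<Prod>a\<in>?U. h a ^ Poly_Mapping.lookup u a)" if "Poly_Mapping.keys u \<subseteq> ?U" for u
    using that by (intro prod.mono_neutral_left) (auto simp: in_keys_iff)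
  show ?thesis
    using extend[OF keys_add] extend[of s] extend[of t]
    by (simp add: lookup_add power_add prod.distrib)
qed

lemma eval_at_coeffs_mult: "eval_at_coeffs (P * Q) G = eval_at_coeffs P G * eval_at_coeffs Q G"
proof -
  let ?m = "\<lambda>t. \<Prod>a\<in>Poly_Mapping.keys t. Poly_Mapping.lookup G a ^ Poly_Mapping.lookup t a"
  have "eval_at_coeffs (P * Q) G = (\<Sum>s\<in>Poly_Mapping.keys P. \<Sum>t\<in>Poly_Mapping.keys Q.
      (Poly_Mapping.lookup P s * ?m s) * (Poly_Mapping.lookup Q t * ?m t))"
    unfolding mult_expand eval_at_coeffs_sum eval_at_coeffs_single prod_power_lookup_add
    by (intro sum.cong refl) (simp only: mult_ac)
  also have "\<dots> = eval_at_coeffs P G * eval_at_coeffs Q G"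
    unfolding eval_at_coeffs_def by (rule sum_product[symmetric])
  finally show ?thesis .
qed

section \<open>Closure properties of generic conditions\<close>

lemma holds_for_generic_form_mono:
  assumes "holds_for_generic_form e A" "\<And>G. G \<in> forms e \<Longrightarrow> A G \<Longrightarrow> B G"
  shows "holds_for_generic_form e B"
  using assms unfolding holds_for_generic_form_def by blast

text \<open>The witness is the product of the two given polynomials. It is nonzero because
  polynomials in the coefficient variables have no zero divisors, even where the field is finite and
  evaluation is not faithful.\<close>

lemma holds_for_generic_form_conj:
  fixes A B :: "('n::finite, 'k::field) mpoly \<Rightarrow> bool"
  assumes "holds_for_generic_form e A" "holds_for_generic_form e B"
  shows "holds_for_generic_form e (\<lambda>G. A G \<and> B G)"
proof -
  let ?vars = "\<lambda>P :: ('n monom, 'k) mpoly.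
    \<forall>t\<in>Poly_Mapping.keys P. \<forall>a\<in>Poly_Mapping.keys t. mdeg a = e"
  obtain P Q :: "('n monom, 'k) mpoly" where P: "P \<noteq> 0" "?vars P"
      "\<forall>G\<in>forms e. eval_at_coeffs P G \<noteq> 0 \<longrightarrow> A G"
    and Q: "Q \<noteq> 0" "?vars Q" "\<forall>G\<in>forms e. eval_at_coeffs Q G \<noteq> 0 \<longrightarrow> B G"
    using assms unfolding holds_for_generic_form_def by blast
  obtain f :: "'n monom \<Rightarrow> nat" where f: "inj f" using ex_inj_monom_nat by blast
  obtain lt :: "'n monom monom \<Rightarrow> 'n monom monom \<Rightarrow> bool" where "monomial_order lt"
    by (rule ex_monomial_order[OF f])
  hence "P * Q \<noteq> 0" using P(1) Q(1) by (rule monomial_order_mult_nonzero)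
  moreover have "?vars (P * Q)"
  proof (intro ballI)
    fix t a assume t: "t \<in> Poly_Mapping.keys (P * Q)" "a \<in> Poly_Mapping.keys t"
    then obtain t1 t2 where "t = t1 + t2" "t1 \<in> Poly_Mapping.keys P" "t2 \<in> Poly_Mapping.keys Q"
      using keys_mult[of P Q] by blast
    thus "mdeg a = e" using P(2) Q(2) t(2) keys_add[of t1 t2] by blast
  qed
  ultimately show ?thesis
    unfolding holds_for_generic_form_def using P(3) Q(3)
    by (intro exI[of _ "P * Q"]) (auto simp: eval_at_coeffs_mult)
qed

lemma holds_for_generic_form_True: "holds_for_generic_form e (\<lambda>_. True)"
  unfolding holds_for_generic_form_def by (rule exI[of _ 1]) simp

text \<open>Finiteness of \<open>I\<close> is essential, since witnesses are multiplied. Genericity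
  is therefore imposed per set of monomials, of which there are finitely many in each degree, and
  not per monomial order.\<close>

lemma holds_for_generic_form_ball:
  assumes "finite I" "\<And>i. i \<in> I \<Longrightarrow> holds_for_generic_form e (A i)"
  shows "holds_for_generic_form e (\<lambda>G. \<forall>i\<in>I. A i G)"
  using assms
proof (induction I rule: finite_induct)
  case empty
  show ?case using holds_for_generic_form_True by simp
next
  case (insert i I)
  hence "holds_for_generic_form e (\<lambda>G. A i G \<and> (\<forall>j\<in>I. A j G))"
    by (intro holds_for_generic_form_conj) auto
  thus ?case by simp
qed

section \<open>Generic nondegeneracy\<close>

text \<open>The exponent vector in question is that of a product of coefficient variables. As
  \<open>s\<close> may repeat values, multiplicities accumulate in the exponents.\<close>

lemma prod_power_lookup_sum_single:
  fixes h :: "'a \<Rightarrow> 'b::comm_semiring_1"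
  assumes "finite I"
  shows "(\<Prod>a\<in>Poly_Mapping.keys (\<Sum>i\<in>I. Poly_Mapping.single (s i) (1::nat)).
      h a ^ Poly_Mapping.lookup (\<Sum>i\<in>I. Poly_Mapping.single (s i) 1) a) = (\<Prod>i\<in>I. h (s i))"
  using assms
proof (induction I rule: finite_induct)
  case (insert i I)
  show ?case unfolding sum.insert[OF insert.hyps] prod.insert[OF insert.hyps]
    prod_power_lookup_add insert.IH by simp
qed simp

text \<open>
  If \<open>k\<close> is the least index moved by \<open>p\<close>, the monomial \<open>s k + t k\<close> occurs on the diagonal, but every
  \<open>s (p i) + t i\<close> is strictly larger (\<open>i < k\<close>) or strictly smaller (\<open>i \<ge> k\<close>).
\<close>

lemma permutation_eq_id_of_sum_single_eq:
  fixes s t :: "nat \<Rightarrow> 'x monom"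
  assumes lt: "monomial_order lt"
    and s: "\<And>i j. i < j \<Longrightarrow> j < M \<Longrightarrow> lt (s j) (s i)"
    and t: "\<And>i j. i < j \<Longrightarrow> j < M \<Longrightarrow> lt (t j) (t i)"
    and p: "p permutes {0..<M}"
    and eq: "(\<Sum>i\<in>{0..<M}. Poly_Mapping.single (s (p i) + t i) (1::nat)) =
      (\<Sum>i\<in>{0..<M}. Poly_Mapping.single (s i + t i) 1)"
  shows "p = id"
proof (rule ccontr)
  assume "p \<noteq> id"
  hence ex: "\<exists>k. p k \<noteq> k" by (auto simp: fun_eq_iff)
  define k where "k = (LEAST k. p k \<noteq> k)"
  have k: "p k \<noteq> k" unfolding k_def by (rule LeastI_ex[OF ex])
  have fixed: "p i = i" if "i < k" for i
    using not_less_Least[of i "\<lambda>k. p k \<noteq> k"] that unfolding k_def by blast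
  have inj: "p i = p j \<Longrightarrow> i = j" for i j using permutes_inj[OF p] by (simp add: inj_eq)
  have "k < M" using k permutes_not_in[OF p, of k] by (cases "k < M") auto
  \<comment> \<open>The values below \<open>k\<close> are already taken by the fixed points below
    \<open>k\<close>.\<close>
  have ge: "p i \<ge> k" if "i \<ge> k" for i
    using fixed[of "p i"] inj[of "p i" i] that by (cases "p i < k") auto
  have bound: "p i < M" if "i < M" for i using permutes_in_image[OF p, of i] that by auto
  let ?v = "s k + t k"
  have "0 < Poly_Mapping.lookup (\<Sum>i\<in>{0..<M}. Poly_Mapping.single (s i + t i) (1::nat)) ?v"
    unfolding lookup_sum using \<open>k < M\<close> by (subst sum.remove[of _ k]) auto
  \<comment> \<open>By \<open>eq\<close> the variable \<open>?v\<close> must also occur in the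
    monomial belonging to \<open>p\<close>, at some index \<open>i\<close>.\<close>
  hence "(\<Sum>i\<in>{0..<M}. Poly_Mapping.lookup (Poly_Mapping.single (s (p i) + t i) (1::nat)) ?v) \<noteq> 0"
    unfolding eq[symmetric] lookup_sum by (rule less_imp_neq[symmetric])
  then obtain i where i: "i \<in> {0..<M}"
      "Poly_Mapping.lookup (Poly_Mapping.single (s (p i) + t i) (1::nat)) ?v \<noteq> 0"
    by (rule sum.not_neutral_contains_not_neutral)
  hence v: "s (p i) + t i = ?v" "i < M" by (auto simp: lookup_single when_def split: if_splits)
  consider "i < k" | "i = k" | "k < i" by linarith
  thus False
  proof cases
    case 1
    hence "lt ?v (s i + t i)"
      using s[of i k] t[of i k] \<open>k < M\<close> monomial_order_add_strict_mono(1)[OF lt] by blast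
    thus False using v fixed[OF 1] monomial_orderD(1)[OF lt] by simp
  next
    case 2
    hence "p i > k" using ge[of k] k by auto
    hence "lt (s (p i)) (s k)" using s bound[OF v(2)] by blast
    hence "lt (s (p i) + t i) ?v" unfolding 2 by (rule monomial_orderD(4)[OF lt])
    thus False using v monomial_orderD(1)[OF lt] by simp
  next
    case 3
    hence "lt (s (p i)) (s k) \<or> s (p i) = s k"
      using ge[of i] s[of k "p i"] bound[OF v(2)] by (cases "p i = k") auto
    moreover have "lt (t i) (t k)" using t 3 v(2) by blast
    ultimately have "lt (s (p i) + t i) ?v" by (rule monomial_order_add_strict_mono(2)[OF lt])
    thus False using v monomial_orderD(1)[OF lt] by simp
  qed
qed

lemma mdeg_add: "mdeg (a + b) = mdeg a + mdeg b"
  by (simp add: mdeg_def lookup_add sum.distrib)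

lemma finite_mdeg_eq: "finite {a :: 'n::finite monom. mdeg a = d}"
proof (rule finite_imageD)
  have "Poly_Mapping.lookup a i \<le> mdeg a" for a :: "'n monom" and i
    unfolding mdeg_def by (rule member_le_sum) auto
  hence "Poly_Mapping.lookup ` {a :: 'n monom. mdeg a = d} \<subseteq> (UNIV \<rightarrow>\<^sub>E {..d})"
    by auto
  thus "finite (Poly_Mapping.lookup ` {a :: 'n monom. mdeg a = d})"
    by (rule finite_subset) (simp add: finite_PiE)
  show "inj_on Poly_Mapping.lookup {a :: 'n monom. mdeg a = d}"
    by (rule inj_onI) (simp only: poly_mapping_eq_iff)
qed

text \<open>The two conjuncts are injectivity and surjectivity of the linear map from coefficient
  vectors on \<open>A\<close> to vectors on \<open>B\<close> with matrix \<open>K\<close>. Only the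
  values of \<open>v\<close> on \<open>A\<close> and of \<open>w\<close> on \<open>B\<close> matter,
  so total functions stand for vectors.\<close>

definition nondegenerate ::
    "('n monom \<Rightarrow> 'n monom \<Rightarrow> 'k::field) \<Rightarrow> 'n monom set \<Rightarrow> 'n monom set \<Rightarrow> bool" where
  "nondegenerate K A B \<longleftrightarrow>
    (\<forall>v. (\<forall>b\<in>B. (\<Sum>a\<in>A. v a * K a b) = 0) \<longrightarrow> (\<forall>a\<in>A. v a = 0)) \<and>
    (\<forall>w. \<exists>v. \<forall>b\<in>B. (\<Sum>a\<in>A. v a * K a b) = w b)"

lemma nondegenerate_if_det_nonzero:
  assumes s: "bij_betw s {0..<M} A" and t: "bij_betw t {0..<M} B"
    and det: "det (mat M M (\<lambda>(j, i). K (s i) (t j))) \<noteq> 0"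
  shows "nondegenerate K A B"
proof -
  let ?X = "mat M M (\<lambda>(j, i). K (s i) (t j))"
  have X: "?X \<in> carrier_mat M M" by simp
  \<comment> \<open>Rows of \<open>?X\<close> follow \<open>t\<close> and columns follow
    \<open>s\<close>; reindexing along \<open>s\<close> turns the matrix product into a sum over
    \<open>A\<close>.\<close>
  have mult: "(?X *\<^sub>v vec M (\<lambda>i. v (s i))) $ j = (\<Sum>a\<in>A. v a * K a (t j))" if "j < M" for v j
  proof -
    have "(?X *\<^sub>v vec M (\<lambda>i. v (s i))) $ j = (\<Sum>i\<in>{0..<M}. v (s i) * K (s i) (t j))"
      using that by (auto simp: scalar_prod_def mult.commute intro!: sum.cong)
    also have "\<dots> = (\<Sum>a\<in>A. v a * K a (t j))"
      by (rule sum.reindex_bij_betw[OF s])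
    finally show ?thesis .
  qed
  have B: "\<exists>j<M. b = t j" if "b \<in> B" for b using t that unfolding bij_betw_def by auto
  have A: "\<exists>i<M. a = s i" if "a \<in> A" for a using s that unfolding bij_betw_def by auto
  have tB: "t j \<in> B" if "j < M" for j using bij_betwE[OF t] that by auto
  have "\<forall>a\<in>A. v a = 0" if v: "\<forall>b\<in>B. (\<Sum>a\<in>A. v a * K a b) = 0" for v
  proof -
    have "?X *\<^sub>v vec M (\<lambda>i. v (s i)) = 0\<^sub>v M"
      by (rule eq_vecI) (use v tB in \<open>auto simp: mult simp del: index_mult_mat_vec\<close>)
    hence "vec M (\<lambda>i. v (s i)) = 0\<^sub>v M"
      using det det_0_iff_vec_prod_zero_field[OF X] vec_carrier by blast
    hence "v (s i) = 0" if "i < M" for i using that by (metis index_vec index_zero_vec(1))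
    thus ?thesis using A by blast
  qed
  moreover have "\<exists>v. \<forall>b\<in>B. (\<Sum>a\<in>A. v a * K a b) = w b" for w
  proof -
    \<comment> \<open>Surjectivity comes from a right inverse \<open>Y\<close>; the argument
      \<open>()\<close> fills the extension slot of the matrix ring record.\<close>
    from det_non_zero_imp_unit[OF X det, of "()"]
    obtain Y where Y: "Y \<in> carrier_mat M M" "?X * Y = 1\<^sub>m M"
      unfolding Units_def ring_mat_def by auto
    define u where "u = Y *\<^sub>v vec M (\<lambda>j. w (t j))"
    have u: "u \<in> carrier_vec M" unfolding u_def using Y(1) by simp
    have Xu: "?X *\<^sub>v u = vec M (\<lambda>j. w (t j))"
      unfolding u_def using assoc_mult_mat_vec[OF X Y(1), of "vec M (\<lambda>j. w (t j))"] Y(2) by simp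
    \<comment> \<open>The solution \<open>u\<close> of the indexed system is carried back to
      \<open>A\<close> along the inverse of \<open>s\<close>.\<close>
    define v where "v a = u $ (inv_into {0..<M} s a)" for a
    have "vec M (\<lambda>i. v (s i)) = u"
      using u s by (intro eq_vecI) (auto simp: v_def bij_betw_def inv_into_f_f)
    hence "(\<Sum>a\<in>A. v a * K a (t j)) = w (t j)" if "j < M" for j
      using mult[OF that, of v] Xu that by simp
    thus ?thesis using B by blast
  qed
  ultimately show ?thesis unfolding nondegenerate_def by blast
qed

text \<open>The Leibniz expansion, read with coefficient variables in place of the coefficients of
  \<open>G\<close>, is the witness. The constants \<open>c\<close> only rescale its terms, so their
  being nonzero keeps the diagonal term alive.\<close>

lemma generic_pairing_nondegenerate:
  fixes c :: "'n::finite monom \<Rightarrow> 'n monom \<Rightarrow> 'k::field"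
  assumes A: "A \<subseteq> {a. mdeg a = d}" and B: "B \<subseteq> {b. mdeg b = d'}" and de: "d + d' = e"
    and card: "card A = card B" and c: "\<And>a b. c a b \<noteq> 0"
  shows "holds_for_generic_form e
    (\<lambda>G. nondegenerate (\<lambda>a b. c a b * Poly_Mapping.lookup G (a + b)) A B)"
proof -
  define M where "M = card A"
  obtain f :: "'n \<Rightarrow> nat" where f: "inj f" using inj_to_nat by blast
  \<comment> \<open>This order is auxiliary and unrelated to the order used for the initial
    ideal.\<close>
  obtain lt :: "'n monom \<Rightarrow> 'n monom \<Rightarrow> bool" where lt: "monomial_order lt"
    by (rule ex_monomial_order[OF f])
  obtain s where s: "bij_betw s {0..<M} A" "\<And>i j. i < j \<Longrightarrow> j < M \<Longrightarrow> lt (s j) (s i)"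
    using ex_decreasing_enumeration[OF lt finite_subset[OF A finite_mdeg_eq]]
    unfolding M_def by blast
  obtain t where t: "bij_betw t {0..<M} B" "\<And>i j. i < j \<Longrightarrow> j < M \<Longrightarrow> lt (t j) (t i)"
    using ex_decreasing_enumeration[OF lt finite_subset[OF B finite_mdeg_eq]]
    unfolding M_def card by blast
  define Perms where "Perms = {p. p permutes {0..<M}}"
  have fin: "finite Perms" unfolding Perms_def by (simp add: finite_permutations)
  \<comment> \<open>\<open>m p\<close> and \<open>\<gamma> p\<close> are exponent vector and
    coefficient of the Leibniz term of \<open>p\<close>. Different permutations may share the same
    \<open>m p\<close>.\<close>
  define m where "m p = (\<Sum>i\<in>{0..<M}. Poly_Mapping.single (s (p i) + t i) (1::nat))" for p
  define \<gamma> where "\<gamma> p = signof p * (\<Prod>i\<in>{0..<M}. c (s (p i)) (t i))" for p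
  define P :: "('n monom, 'k) mpoly" where "P = (\<Sum>p\<in>Perms. Poly_Mapping.single (m p) (\<gamma> p))"
  have diagonal: "p = id" if "p \<in> Perms" "m p = m id" for p
  proof (rule permutation_eq_id_of_sum_single_eq[OF lt s(2) t(2)])
    show "p permutes {0..<M}" using that(1) unfolding Perms_def by simp
    show "(\<Sum>i\<in>{0..<M}. Poly_Mapping.single (s (p i) + t i) (1::nat)) =
        (\<Sum>i\<in>{0..<M}. Poly_Mapping.single (s i + t i) 1)"
      using that(2) unfolding m_def id_apply .
  qed
  have "id \<in> Perms" unfolding Perms_def by (simp add: permutes_id)
  \<comment> \<open>Only the identity yields the exponent \<open>m id\<close>, so its coefficient is
    a product of values of \<open>c\<close>, with sign 1.\<close>
  have "Poly_Mapping.lookup P (m id) = (\<Sum>p\<in>Perms. if p = id then \<gamma> id else 0)"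
    unfolding P_def lookup_sum
    by (intro sum.cong refl) (auto simp: lookup_single when_def dest: diagonal)
  also have "\<dots> = \<gamma> id" using fin \<open>id \<in> Perms\<close> by simp
  finally have "Poly_Mapping.lookup P (m id) \<noteq> 0" using c by (simp add: \<gamma>_def)
  hence "P \<noteq> 0" by (metis lookup_zero)
  moreover have "\<forall>t\<in>Poly_Mapping.keys P. \<forall>a\<in>Poly_Mapping.keys t. mdeg a = e"
  proof (intro ballI)
    fix t' a assume "t' \<in> Poly_Mapping.keys P" and a: "a \<in> Poly_Mapping.keys t'"
    then obtain p where p: "p \<in> Perms" "t' = m p"
      using keys_sum[of "\<lambda>p. Poly_Mapping.single (m p) (\<gamma> p)" Perms]
      unfolding P_def by (force split: if_splits)
    then obtain i where i: "i < M" "a = s (p i) + t i"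
      using a keys_sum[of "\<lambda>i. Poly_Mapping.single (s (p i) + t i) (1::nat)" "{0..<M}"]
      unfolding m_def by force
    have "p i < M" using p(1) i(1) permutes_in_image[of p "{0..<M}" i] unfolding Perms_def by auto
    hence "s (p i) \<in> A" "t i \<in> B" using bij_betwE[OF s(1)] bij_betwE[OF t(1)] i(1) by auto
    thus "mdeg a = e" using A B de i(2) by (auto simp: mdeg_add)
  qed
  moreover have "nondegenerate (\<lambda>a b. c a b * Poly_Mapping.lookup G (a + b)) A B"
    if "eval_at_coeffs P G \<noteq> 0" for G
  proof (rule nondegenerate_if_det_nonzero[OF s(1) t(1)])
    have "eval_at_coeffs P G =
        (\<Sum>p\<in>Perms. \<gamma> p * (\<Prod>i\<in>{0..<M}. Poly_Mapping.lookup G (s (p i) + t i)))"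
      unfolding P_def eval_at_coeffs_sum eval_at_coeffs_single m_def
      by (simp only: prod_power_lookup_sum_single finite_atLeastLessThan)
    also have "\<dots> = (\<Sum>p\<in>Perms. signof p * (\<Prod>i\<in>{0..<M}.
        c (s (p i)) (t i) * Poly_Mapping.lookup G (s (p i) + t i)))"
      unfolding \<gamma>_def prod.distrib by (simp only: mult.assoc)
    \<comment> \<open>With rows indexed by \<open>t\<close>, the entry in row \<open>i\<close> and
      column \<open>p i\<close> belongs to \<open>s (p i)\<close> and \<open>t i\<close>, as in
      \<open>m p\<close>.\<close>
    also have "\<dots> = det (mat M M (\<lambda>(j, i). c (s i) (t j) * Poly_Mapping.lookup G (s i + t j)))"
      unfolding Perms_def
      by (subst det_def'[of _ M], simp, intro sum.cong refl arg_cong2[where f = "(*)"] prod.cong)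
         (auto simp: permutes_in_image)
    finally show "det (mat M M (\<lambda>(j, i). c (s i) (t j) * Poly_Mapping.lookup G (s i + t j))) \<noteq> 0"
      using that by simp
  qed
  ultimately show ?thesis unfolding holds_for_generic_form_def by blast
qed

section \<open>The annihilator of a form and its initial ideal\<close>

text \<open>Induction on the degree peels off one variable at a time; each contributes a factor that
  depends on the exponents but not on \<open>g\<close>.\<close>

lemma ex_monom_act_coeff:
  fixes a :: "'n::finite monom"
  shows "\<exists>c :: 'n monom \<Rightarrow> 'k::field. \<forall>b. c b \<noteq> 0 \<and>
    (\<forall>g. Poly_Mapping.lookup (monom_act a g) b = c b * Poly_Mapping.lookup g (a + b))"
proof (induction "mdeg a" arbitrary: a)
  case 0
  hence "a = 0" by (intro poly_mapping_eqI) (simp add: mdeg_def)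
  thus ?case by (intro exI[of _ "\<lambda>_. 1"]) (simp add: monom_act_zero)
next
  case (Suc m)
  have "\<exists>i. Poly_Mapping.lookup a i \<noteq> 0"
  proof (rule ccontr)
    assume "\<nexists>i. Poly_Mapping.lookup a i \<noteq> 0"
    thus False using Suc.hyps(2) by (simp add: mdeg_def)
  qed
  then obtain i where i: "Poly_Mapping.lookup a i \<noteq> 0" ..
  define a' where "a' = a - Poly_Mapping.single i 1"
  have a: "a = a' + Poly_Mapping.single i 1"
    using i by (intro poly_mapping_eqI)
      (auto simp: a'_def lookup_add lookup_minus lookup_single when_def)
  have "mdeg (Poly_Mapping.single i 1) = 1"
    unfolding mdeg_def lookup_single when_def by simp
  hence "m = mdeg a'" using Suc.hyps(2) mdeg_add[of a' "Poly_Mapping.single i 1"] a by simp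
  from Suc.hyps(1)[OF this] obtain c :: "'n monom \<Rightarrow> 'k" where c: "\<And>b. c b \<noteq> 0"
    "\<And>b g. Poly_Mapping.lookup (monom_act a' g) b = c b * Poly_Mapping.lookup g (a' + b)" by blast
  let ?u = "\<lambda>b. if CHAR('k) = 0 then of_nat (Suc (Poly_Mapping.lookup b i)) else (1::'k)"
  \<comment> \<open>A positive integer factor arises only in characteristic zero, where it is
    nonzero in the field; contraction contributes the factor 1.\<close>
  have u: "?u b \<noteq> 0" for b
    by (simp only: of_nat_eq_0_iff_char_dvd split: if_split) simp
  show ?case
  proof (intro exI[of _ "\<lambda>b. c b * ?u (a' + b)"] allI conjI)
    fix b show "c b * ?u (a' + b) \<noteq> 0" using c(1) u by (simp only: mult_eq_0_iff simp_thms)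
    fix g :: "('n, 'k) mpoly"
    have "a' + b + Poly_Mapping.single i 1 = a + b" by (simp add: a ac_simps)
    thus "Poly_Mapping.lookup (monom_act a g) b =
        c b * ?u (a' + b) * Poly_Mapping.lookup g (a + b)"
      by (subst a) (simp only: monom_act_add_exponent monom_act_single c(2) lookup_var_act mult.assoc)
  qed
qed

text \<open>In characteristic zero this is the product of the quotients (a_i + b_i)! / b_i!, in
  positive characteristic it is 1. Reading it off from one monomial avoids a case
  distinction.\<close>

definition act_coeff :: "'n::finite monom \<Rightarrow> 'n monom \<Rightarrow> 'k::field" where
  "act_coeff a b = Poly_Mapping.lookup (monom_act a (monom_poly (a + b))) b"

lemma act_coeff:
  fixes a :: "'n::finite monom" and g :: "('n, 'k::field) mpoly"
  shows act_coeff_nonzero: "act_coeff a b \<noteq> (0::'k)"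
    and lookup_monom_act:
      "Poly_Mapping.lookup (monom_act a g) b = act_coeff a b * Poly_Mapping.lookup g (a + b)"
proof -
  obtain c :: "'n monom \<Rightarrow> 'k" where c: "\<And>b. c b \<noteq> 0"
    "\<And>b g. Poly_Mapping.lookup (monom_act a g) b = c b * Poly_Mapping.lookup g (a + b)"
    using ex_monom_act_coeff[of a] by blast
  have "act_coeff a b = c b" unfolding act_coeff_def c(2) by simp
  thus "act_coeff a b \<noteq> (0::'k)"
    "Poly_Mapping.lookup (monom_act a g) b = act_coeff a b * Poly_Mapping.lookup g (a + b)"
    using c by simp_all
qed

lemma in_Ann_iff:
  assumes "finite A" "Poly_Mapping.keys f \<subseteq> A"
  shows "f \<in> Ann G \<longleftrightarrow> (\<forall>b. (\<Sum>a\<in>A. Poly_Mapping.lookup f a *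
    (act_coeff a b * Poly_Mapping.lookup G (a + b))) = 0)"
proof -
  have "act f G = (\<Sum>a\<in>A. cmul (Poly_Mapping.lookup f a) (monom_act a G))"
    by (rule act_superset[OF assms])
  thus ?thesis unfolding Ann_def poly_mapping_eq_iff fun_eq_iff mem_Collect_eq
    by (simp add: lookup_sum lookup_cmul lookup_monom_act)
qed

lemma lookup_form: "G \<in> forms e \<Longrightarrow> mdeg a \<noteq> e \<Longrightarrow> Poly_Mapping.lookup G a = 0"
  unfolding forms_def by (auto simp: in_keys_iff)

text \<open>A coefficient of \<open>G\<close> at \<open>a + b\<close> can be nonzero only in degree
  \<open>e\<close>, so the equations for other degrees of \<open>b\<close> are trivial. What remains
  is the catalecticant system.\<close>

lemma form_in_Ann_iff:
  fixes f :: "('n::finite, 'k::field) mpoly"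
  assumes G: "G \<in> forms e" and "d \<le> e"
    and A: "Poly_Mapping.keys f \<subseteq> A" "A \<subseteq> {a. mdeg a = d}"
  shows "f \<in> Ann G \<longleftrightarrow> (\<forall>b\<in>{b. mdeg b = e - d}. (\<Sum>a\<in>A. Poly_Mapping.lookup f a *
    (act_coeff a b * Poly_Mapping.lookup G (a + b))) = 0)"
proof -
  have "finite A" using A(2) finite_mdeg_eq by (rule finite_subset)
  moreover have "(\<Sum>a\<in>A. Poly_Mapping.lookup f a *
      (act_coeff a b * Poly_Mapping.lookup G (a + b))) = 0" if "mdeg b \<noteq> e - d" for b
  proof (rule sum.neutral, rule ballI)
    fix a assume "a \<in> A"
    hence "mdeg (a + b) \<noteq> e" using A(2) that by (auto simp: mdeg_add)
    from lookup_form[OF G this] show "Poly_Mapping.lookup f a *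
      (act_coeff a b * Poly_Mapping.lookup G (a + b)) = 0" by simp
  qed
  ultimately show ?thesis using in_Ann_iff[OF _ A(1), of G] by blast
qed

definition component :: "nat \<Rightarrow> ('n::finite, 'k::field) mpoly \<Rightarrow> ('n, 'k) mpoly" where
  "component d f = (\<Sum>a\<in>{a. mdeg a = d}. Poly_Mapping.single a (Poly_Mapping.lookup f a))"

lemma lookup_component:
  "Poly_Mapping.lookup (component d f) a = (if mdeg a = d then Poly_Mapping.lookup f a else 0)"
  unfolding component_def lookup_sum lookup_single when_def by (simp add: finite_mdeg_eq)

lemma keys_component: "Poly_Mapping.keys (component d f) = {a \<in> Poly_Mapping.keys f. mdeg a = d}"
  by (auto simp: in_keys_iff lookup_component split: if_splits)

text \<open>The annihilator of a form is homogeneous: the equation at \<open>b\<close> involves only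
  exponents of degree \<open>e - mdeg b\<close>. It is thus either the equation already satisfied by
  \<open>f\<close>, or trivial for the component.\<close>

lemma component_in_Ann:
  fixes f :: "('n::finite, 'k::field) mpoly"
  assumes G: "G \<in> forms e" and f: "f \<in> Ann G"
  shows "component d f \<in> Ann G"
proof -
  let ?K = "\<lambda>a b. act_coeff a b * Poly_Mapping.lookup G (a + b)"
  have "(\<Sum>a\<in>Poly_Mapping.keys f. Poly_Mapping.lookup (component d f) a * ?K a b) = 0" for b
  proof -
    have eq: "Poly_Mapping.lookup (component d f) a * ?K a b =
        (if mdeg b + d = e then Poly_Mapping.lookup f a * ?K a b else 0)" for a
      using lookup_form[OF G, of "a + b"] by (auto simp: lookup_component mdeg_add)
    have "(\<Sum>a\<in>Poly_Mapping.keys f. Poly_Mapping.lookup f a * ?K a b) = 0"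
      using f in_Ann_iff[OF finite_keys order_refl] by blast
    thus ?thesis unfolding eq
      by (cases "mdeg b + d = e") (simp_all only: refl if_True if_False sum.neutral_const)
  qed
  thus ?thesis by (subst in_Ann_iff[of "Poly_Mapping.keys f"]) (auto simp: keys_component)
qed

lemma mult_in_Ann: "f \<in> Ann G \<Longrightarrow> h * f \<in> Ann G"
  \<comment> \<open>The empty sum gives \<open>act h 0 = 0\<close>.\<close>
  unfolding Ann_def using act_sum_right[of h _ "{}"] by (simp add: act_mult)

section \<open>Leading monomials and the monomials of an initial ideal\<close>

lemma lead_monom_eqI:
  assumes lt: "monomial_order lt" and "a \<in> Poly_Mapping.keys f"
    and "\<And>b. b \<in> Poly_Mapping.keys f \<Longrightarrow> b \<noteq> a \<Longrightarrow> lt b a"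
  shows "lead_monom lt f = a"
  unfolding lead_monom_def
proof (rule the_equality)
  fix a' assume a': "a' \<in> Poly_Mapping.keys f \<and> (\<forall>b\<in>Poly_Mapping.keys f. b \<noteq> a' \<longrightarrow> lt b a')"
  show "a' = a"
  proof (rule ccontr)
    assume "a' \<noteq> a"
    hence "lt a' a" "lt a a'" using a' assms(2,3) by auto
    thus False using monomial_orderD(1,2)[OF lt] by blast
  qed
qed (use assms in blast)

lemma lead_monom:
  assumes lt: "monomial_order lt" and "f \<noteq> 0"
  shows "lead_monom lt f \<in> Poly_Mapping.keys f"
    and "b \<in> Poly_Mapping.keys f \<Longrightarrow> b \<noteq> lead_monom lt f \<Longrightarrow> lt b (lead_monom lt f)"
proof -
  have "Poly_Mapping.keys f \<noteq> {}" using \<open>f \<noteq> 0\<close> by simp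
  then obtain a where a: "a \<in> Poly_Mapping.keys f"
      "\<And>b. b \<in> Poly_Mapping.keys f \<Longrightarrow> b \<noteq> a \<Longrightarrow> lt b a"
    using monomial_order_max[OF lt finite_keys] by blast
  have "lead_monom lt f = a" using a by (rule lead_monom_eqI[OF lt])
  thus "lead_monom lt f \<in> Poly_Mapping.keys f"
    "b \<in> Poly_Mapping.keys f \<Longrightarrow> b \<noteq> lead_monom lt f \<Longrightarrow> lt b (lead_monom lt f)" using a by auto
qed

text \<open>Multiplication by a monomial translates exponents injectively, so no terms merge or
  cancel.\<close>

lemma keys_monom_poly_mult:
  fixes f :: "('n, 'k::field) mpoly"
  shows "Poly_Mapping.keys (monom_poly c * f) = (+) c ` Poly_Mapping.keys f"
proof -
  have lookup: "Poly_Mapping.lookup (monom_poly c * f) (c + a) = Poly_Mapping.lookup f a" for a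
  proof (cases "a \<in> Poly_Mapping.keys f")
    case True
    hence "Poly_Mapping.lookup (monom_poly c * f) (c + a) =
        Poly_Mapping.lookup (monom_poly c :: ('n, 'k) mpoly) c * Poly_Mapping.lookup f a"
      by (intro lookup_mult_unique) auto
    thus ?thesis by simp
  next
    case False
    hence "c + a \<notin> Poly_Mapping.keys (monom_poly c * f)"
      using keys_mult[of "monom_poly c" f] by auto
    thus ?thesis using False by (simp add: in_keys_iff)
  qed
  show "Poly_Mapping.keys (monom_poly c * f) = (+) c ` Poly_Mapping.keys f"
  proof (intro equalityI subsetI)
    fix x assume x: "x \<in> Poly_Mapping.keys (monom_poly c * f)"
    then obtain a where a: "x = c + a" "a \<in> Poly_Mapping.keys f"
      using keys_mult[of "monom_poly c" f] by auto
    thus "x \<in> (+) c ` Poly_Mapping.keys f" by blast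
  next
    fix x assume "x \<in> (+) c ` Poly_Mapping.keys f"
    thus "x \<in> Poly_Mapping.keys (monom_poly c * f)" by (auto simp: in_keys_iff lookup)
  qed
qed

lemma lead_monom_monom_poly_mult:
  assumes lt: "monomial_order lt" and f: "f \<noteq> (0 :: ('n, 'k::field) mpoly)"
  shows "lead_monom lt (monom_poly c * f) = c + lead_monom lt f"
  using lead_monom[OF lt f] monomial_orderD(5)[OF lt]
  by (intro lead_monom_eqI[OF lt]) (auto simp: keys_monom_poly_mult)

text \<open>This makes the theory of spans available for \<open>ideal_gen\<close>.\<close>

lemma module_mult: "Modules.module ((*) :: 'a::comm_ring_1 \<Rightarrow> 'a \<Rightarrow> 'a)"
  by (rule Modules.module.intro) (simp_all add: distrib_left distrib_right mult.assoc)

text \<open>The polynomials all of whose monomials are leading monomials of elements of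
  \<open>I\<close> form an ideal, because \<open>I\<close> is closed under multiplication by
  monomials, which shifts leading monomials. This ideal contains the generators.\<close>

lemma keys_initial_ideal:
  fixes I :: "('n, 'k::field) mpoly set"
  assumes lt: "monomial_order lt" and I: "\<And>h f. f \<in> I \<Longrightarrow> h * f \<in> I"
    and g: "g \<in> initial_ideal lt I" and a: "a \<in> Poly_Mapping.keys g"
  shows "\<exists>f\<in>I. f \<noteq> 0 \<and> a = lead_monom lt f"
proof -
  interpret R: Modules.module "(*) :: ('n, 'k) mpoly \<Rightarrow> _"
    by (rule module_mult)
  let ?P = "{g :: ('n, 'k) mpoly. \<forall>a\<in>Poly_Mapping.keys g. \<exists>f\<in>I. f \<noteq> 0 \<and> a = lead_monom lt f}"
  have sub: "R.subspace ?P"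
    unfolding R.subspace_def
  proof (intro conjI ballI allI)
    show "0 \<in> ?P" by simp
    fix x y assume "x \<in> ?P" "y \<in> ?P"
    thus "x + y \<in> ?P" using keys_add[of x y] by blast
  next
    fix h x assume x: "x \<in> ?P"
    show "h * x \<in> ?P"
    proof (intro CollectI ballI)
      fix a assume "a \<in> Poly_Mapping.keys (h * x)"
      then obtain c b where a: "a = c + b" "b \<in> Poly_Mapping.keys x"
        using keys_mult[of h x] by blast
      then obtain f where f: "f \<in> I" "f \<noteq> 0" "b = lead_monom lt f" using x by blast
      have "monom_poly c * f \<noteq> 0"
        using keys_monom_poly_mult[of c f] f(2) by (metis image_is_empty keys_eq_empty)
      moreover have "a = lead_monom lt (monom_poly c * f)"
        unfolding lead_monom_monom_poly_mult[OF lt f(2)] using a(1) f(3) by simp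
      ultimately show "\<exists>f\<in>I. f \<noteq> 0 \<and> a = lead_monom lt f" using I[OF f(1)] by blast
    qed
  qed
  have "{monom_poly (lead_monom lt f) | f. f \<in> I \<and> f \<noteq> 0} \<subseteq> ?P"
    by auto
  hence "R.span {monom_poly (lead_monom lt f) | f. f \<in> I \<and> f \<noteq> 0} \<subseteq> ?P"
    using sub by (rule R.span_minimal)
  thus ?thesis using g a unfolding initial_ideal_def by blast
qed

lemma subspace_keys_subset: "mpoly.subspace {g :: ('n, 'k::field) mpoly. Poly_Mapping.keys g \<subseteq> F}"
proof (rule mpoly.subspaceI)
  fix f g :: "('n, 'k) mpoly" and c :: 'k
  assume f: "f \<in> {g. Poly_Mapping.keys g \<subseteq> F}"
  show "cmul c f \<in> {g. Poly_Mapping.keys g \<subseteq> F}"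
    using f by (auto simp: in_keys_iff lookup_cmul)
  assume "g \<in> {g. Poly_Mapping.keys g \<subseteq> F}"
  thus "f + g \<in> {g. Poly_Mapping.keys g \<subseteq> F}" using f keys_add[of f g] by blast
qed simp

text \<open>Scaling by a field element is multiplication by a constant polynomial, so an ideal is a
  linear subspace.\<close>

lemma subspace_initial_ideal_forms:
  fixes I :: "('n::finite, 'k::field) mpoly set"
  shows "mpoly.subspace (initial_ideal lt I \<inter> forms d)"
proof -
  interpret R: Modules.module "(*) :: ('n, 'k) mpoly \<Rightarrow> _"
    by (rule module_mult)
  have "mpoly.subspace (initial_ideal lt I)"
    unfolding mpoly.subspace_def initial_ideal_def cmul_def
    using R.span_zero R.span_add R.span_scale by simp
  moreover have "mpoly.subspace (forms d :: ('n, 'k) mpoly set)"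
    using subspace_keys_subset[of "{a. mdeg a = d}"] unfolding forms_def subset_iff Ball_def by simp
  ultimately show ?thesis by (rule mpoly.subspace_inter)
qed

lemma monom_poly_in_initial_ideal:
  fixes f :: "('n, 'k::field) mpoly"
  assumes "f \<in> I" "f \<noteq> 0"
  shows "monom_poly (lead_monom lt f) \<in> initial_ideal lt I"
proof -
  interpret R: Modules.module "(*) :: ('n, 'k) mpoly \<Rightarrow> _"
    by (rule module_mult)
  show ?thesis unfolding initial_ideal_def using assms by (intro R.span_base) blast
qed

section \<open>Linear spans of monomials and dimensions of graded components\<close>

lemma in_span_monom_poly_iff:
  fixes g :: "('n, 'k::field) mpoly"
  shows "g \<in> mpoly.span (monom_poly ` F) \<longleftrightarrow> Poly_Mapping.keys g \<subseteq> F"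
proof
  have "mpoly.span (monom_poly ` F) \<subseteq> {g :: ('n, 'k) mpoly. Poly_Mapping.keys g \<subseteq> F}"
    by (rule mpoly.span_minimal[OF _ subspace_keys_subset]) auto
  thus "g \<in> mpoly.span (monom_poly ` F) \<Longrightarrow> Poly_Mapping.keys g \<subseteq> F" by blast
next
  assume F: "Poly_Mapping.keys g \<subseteq> F"
  have "cmul c (monom_poly a) = Poly_Mapping.single a c" for a :: "'n monom" and c :: 'k
    unfolding cmul_def by (simp add: mult_single)
  hence "g = (\<Sum>a\<in>Poly_Mapping.keys g. cmul (Poly_Mapping.lookup g a) (monom_poly a))"
    using poly_mapping_expand[of g] by simp
  also have "\<dots> \<in> mpoly.span (monom_poly ` F)"
    using F by (intro mpoly.span_sum mpoly.span_scale mpoly.span_base) auto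
  finally show "g \<in> mpoly.span (monom_poly ` F)" .
qed

lemma dim_forms: "mpoly.dim (forms d :: ('n::finite, 'k::field) mpoly set) =
  card {a :: 'n monom. mdeg a = d}"
proof -
  let ?M = "{a :: 'n monom. mdeg a = d}"
  let ?B = "monom_poly ` ?M :: ('n, 'k) mpoly set"
  have inj: "inj_on (monom_poly :: 'n monom \<Rightarrow> ('n, 'k) mpoly) ?M"
    by (rule inj_onI) (metis keys_single one_neq_zero singleton_inject)
  have "mpoly.independent ?B"
    unfolding mpoly.dependent_def
  proof
    assume "\<exists>x\<in>?B. x \<in> mpoly.span (?B - {x})"
    then obtain a where "(monom_poly a :: ('n, 'k) mpoly) \<in> mpoly.span (?B - {monom_poly a})"
      by blast
    moreover have "?B - {monom_poly a} \<subseteq> monom_poly ` (?M - {a})" by blast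
    ultimately have "(monom_poly a :: ('n, 'k) mpoly) \<in> mpoly.span (monom_poly ` (?M - {a}))"
      using mpoly.span_mono by blast
    thus False unfolding in_span_monom_poly_iff by simp
  qed
  moreover have "mpoly.span ?B = forms d"
    by (auto simp: in_span_monom_poly_iff forms_def)
  ultimately have "mpoly.dim (forms d :: ('n, 'k) mpoly set) = card ?B"
    using mpoly.dim_span_eq_card_independent[of ?B] by simp
  thus ?thesis using card_image[OF inj] by simp
qed

text \<open>Multiplication by a power of one variable is injective. The inequality ensures that the
  difference of dimensions in the theorem is not truncated.\<close>

lemma card_mdeg_eq_mono:
  assumes "d' \<le> d"
  shows "card {a :: 'n::finite monom. mdeg a = d'} \<le> card {a :: 'n monom. mdeg a = d}"
proof (rule card_inj_on_le)
  fix i :: 'n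
  let ?s = "Poly_Mapping.single i (d - d')"
  show "inj_on (\<lambda>a. a + ?s) {a. mdeg a = d'}" by (simp add: inj_on_def)
  have "mdeg ?s = d - d'" unfolding mdeg_def lookup_single when_def by simp
  thus "(\<lambda>a. a + ?s) ` {a. mdeg a = d'} \<subseteq> {a. mdeg a = d}"
    using assms by (auto simp: mdeg_add)
qed (rule finite_mdeg_eq)

text \<open>The statement for a fixed form: injectivity on the small monomials bounds the initial
  ideal from above, surjectivity puts every large monomial into it.\<close>

lemma initial_ideal_Ann_degree:
  fixes G :: "('n::finite, 'k::field) mpoly"
  assumes lt: "monomial_order lt" and G: "G \<in> forms e" and d: "e - d \<le> d" "d \<le> e"
    and nondeg: "\<And>A. A \<subseteq> {a. mdeg a = d} \<Longrightarrow> card A = card {b :: 'n monom. mdeg b = e - d} \<Longrightarrow>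
      nondegenerate (\<lambda>a b. act_coeff a b * Poly_Mapping.lookup G (a + b)) A {b. mdeg b = e - d}"
  shows "initial_ideal lt (Ann G) \<inter> forms d = mpoly.span (monom_poly ` first_monoms lt d
    (card {a :: 'n monom. mdeg a = d} - card {b :: 'n monom. mdeg b = e - d}))"
proof -
  let ?D = "{a :: 'n monom. mdeg a = d}" and ?B = "{b :: 'n monom. mdeg b = e - d}"
  let ?K = "\<lambda>a b. act_coeff a b * Poly_Mapping.lookup G (a + b)"
  define N where "N = card ?D - card ?B"
  define F where "F = first_monoms lt d N"
  \<comment> \<open>These are the smallest monomials of degree \<open>d\<close>, as many as there
    are monomials of degree \<open>e - d\<close>.\<close>
  define A where "A = ?D - F"
  have F: "F = {a \<in> ?D. rank_above lt ?D a < N}"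
    unfolding F_def first_monoms_def rank_above_def by simp
  have "A \<subseteq> ?D" unfolding A_def by blast
  have fin: "finite A" using \<open>A \<subseteq> ?D\<close> finite_mdeg_eq by (rule finite_subset)
  have "card F = N"
  proof -
    note bij = bij_betw_rank_above[OF lt finite_mdeg_eq[of d]]
    have "rank_above lt ?D ` F = {0..<N}"
    proof (intro equalityI subsetI)
      fix i assume "i \<in> {0..<N}"
      moreover from this have "i \<in> rank_above lt ?D ` ?D"
        using bij unfolding bij_betw_def N_def by auto
      ultimately show "i \<in> rank_above lt ?D ` F" unfolding F by auto
    qed (auto simp: F)
    moreover have "inj_on (rank_above lt ?D) F"
      using bij unfolding bij_betw_def F by (auto intro: inj_on_subset)
    ultimately show ?thesis using card_image by fastforce
  qed
  hence "card A = card ?B"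
    unfolding A_def using card_mdeg_eq_mono[OF d(1), where 'n = 'n] finite_mdeg_eq[of d, where 'n = 'n] F
    by (subst card_Diff_subset) (auto simp: N_def intro: finite_subset)
  from nondeg[OF \<open>A \<subseteq> ?D\<close> this]
  have inj: "\<And>v. \<forall>b\<in>?B. (\<Sum>a\<in>A. v a * ?K a b) = 0 \<Longrightarrow> \<forall>a\<in>A. v a = 0"
    and surj: "\<And>w. \<exists>v. \<forall>b\<in>?B. (\<Sum>a\<in>A. v a * ?K a b) = w b"
    unfolding nondegenerate_def by blast+
  have A_below: "lt b a" if "a \<in> F" "b \<in> A" for a b
  proof -
    have "rank_above lt ?D a < rank_above lt ?D b" using that unfolding A_def F by auto
    thus ?thesis using rank_above_less_iff[OF lt finite_mdeg_eq, of b d a] that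
      unfolding A_def F by auto
  qed
  have keys_A: "f = 0" if f: "f \<in> Ann G" "Poly_Mapping.keys f \<subseteq> A" for f
  proof -
    have "\<forall>a\<in>A. Poly_Mapping.lookup f a = 0"
      using in_Ann_iff[OF fin f(2)] f(1) by (intro inj) blast
    hence "Poly_Mapping.keys f = {}" using f(2) by (fastforce simp del: keys_eq_empty simp: in_keys_iff)
    thus ?thesis by simp
  qed
  have "Poly_Mapping.keys g \<subseteq> F" if g: "g \<in> initial_ideal lt (Ann G)" "g \<in> forms d" for g
  proof
    fix a assume a: "a \<in> Poly_Mapping.keys g"
    obtain f where f: "f \<in> Ann G" "f \<noteq> 0" "a = lead_monom lt f"
      using keys_initial_ideal[OF lt mult_in_Ann g(1) a] by blast
    \<comment> \<open>\<open>f\<close> may be inhomogeneous and \<open>lt\<close> need not refine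
      the degree. Its component of degree \<open>d\<close> still lies in \<open>Ann G\<close> and
      still contains \<open>a\<close>.\<close>
    let ?h = "component d f"
    have "mdeg a = d" using a g(2) unfolding forms_def by blast
    hence "a \<in> Poly_Mapping.keys ?h"
      unfolding keys_component using lead_monom(1)[OF lt f(2)] f(3) by blast
    hence "?h \<noteq> 0" by auto
    hence "\<not> Poly_Mapping.keys ?h \<subseteq> A" using keys_A[OF component_in_Ann[OF G f(1)]] by blast
    then obtain b where b: "b \<in> Poly_Mapping.keys f" "b \<in> F"
      unfolding keys_component A_def by blast
    show "a \<in> F"
    proof (rule ccontr)
      assume "a \<notin> F"
      \<comment> \<open>Outside \<open>F\<close> the leading monomial \<open>a\<close> would lie
        below the monomial \<open>b\<close> of the same \<open>f\<close>.\<close>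
      hence "lt a b" using A_below[OF b(2)] \<open>mdeg a = d\<close> unfolding A_def by blast
      moreover have "b \<noteq> a" using \<open>a \<notin> F\<close> b(2) by blast
      hence "lt b a" using lead_monom(2)[OF lt f(2) b(1)] f(3) by blast
      ultimately show False using monomial_orderD(1,2)[OF lt] by blast
    qed
  qed
  moreover have "monom_poly a \<in> initial_ideal lt (Ann G) \<inter> forms d" if a: "a \<in> F" for a
  proof
    \<comment> \<open>The combination of \<open>A\<close> is chosen to cancel the contribution of
      \<open>a\<close> to every equation; since all of \<open>A\<close> lies below \<open>a\<close>,
      the leading monomial stays \<open>a\<close>.\<close>
    obtain v where v: "\<And>b. b \<in> ?B \<Longrightarrow> (\<Sum>c\<in>A. v c * ?K c b) = - ?K a b"
      using surj[of "\<lambda>b. - ?K a b"] by blast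
    define f where "f = Poly_Mapping.single a 1 + (\<Sum>c\<in>A. Poly_Mapping.single c (v c))"
    have "a \<notin> A" "mdeg a = d" using a unfolding A_def F by auto
    have lookup_f: "Poly_Mapping.lookup f c = (if c = a then 1 else if c \<in> A then v c else 0)" for c
      unfolding f_def lookup_add lookup_sum lookup_single when_def
      using \<open>a \<notin> A\<close> fin by auto
    have keys: "Poly_Mapping.keys f \<subseteq> insert a A"
      by (auto simp: in_keys_iff lookup_f split: if_splits)
    have deg: "insert a A \<subseteq> ?D" using \<open>mdeg a = d\<close> \<open>A \<subseteq> ?D\<close> by blast
    have "(\<Sum>c\<in>insert a A. Poly_Mapping.lookup f c * ?K c b) = 0" if "b \<in> ?B" for b
    proof -
      have "(\<Sum>c\<in>A. Poly_Mapping.lookup f c * ?K c b) = (\<Sum>c\<in>A. v c * ?K c b)"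
        using \<open>a \<notin> A\<close> by (intro sum.cong refl) (auto simp: lookup_f)
      thus ?thesis unfolding sum.insert[OF fin \<open>a \<notin> A\<close>] v[OF that] by (simp add: lookup_f)
    qed
    hence "f \<in> Ann G"
      using form_in_Ann_iff[OF G d(2) keys deg] by blast
    moreover have lead: "lead_monom lt f = a"
      using keys A_below[OF a] by (intro lead_monom_eqI[OF lt])
        (auto simp: in_keys_iff lookup_f split: if_splits)
    moreover have "f \<noteq> 0" using lookup_f[of a] by auto
    ultimately show "monom_poly a \<in> initial_ideal lt (Ann G)"
      using monom_poly_in_initial_ideal[of f "Ann G" lt] by simp
    show "monom_poly a \<in> forms d" using \<open>mdeg a = d\<close> unfolding forms_def by simp
  qed
  hence "mpoly.span (monom_poly ` F) \<subseteq> initial_ideal lt (Ann G) \<inter> forms d"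
    by (intro mpoly.span_minimal subspace_initial_ideal_forms) blast
  ultimately show ?thesis
    unfolding N_def[symmetric] F_def[symmetric] using in_span_monom_poly_iff by blast
qed

theorem theorem2p1:
  fixes e :: nat
  shows "holds_for_generic_form e (\<lambda>G :: ('n::finite, 'k::field) mpoly.
    \<forall>lt. monomial_order lt \<longrightarrow>
      (\<forall>d::nat. real e / 2 \<le> real d \<and> d \<le> e \<longrightarrow>
        initial_ideal lt (Ann G) \<inter> forms d =
          mpoly.span (monom_poly ` first_monoms lt d
            (mpoly.dim (forms d :: ('n, 'k) mpoly set)
              - mpoly.dim (forms (e - d) :: ('n, 'k) mpoly set)))))"
proof -
  let ?K = "\<lambda>(G :: ('n, 'k) mpoly) a b. act_coeff a b * Poly_Mapping.lookup G (a + b)"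
  \<comment> \<open>All sets of the required size are taken, so that one polynomial condition on
    \<open>G\<close> is fixed before \<open>lt\<close> is chosen.\<close>
  let ?As = "\<lambda>d. {A. A \<subseteq> {a :: 'n monom. mdeg a = d} \<and>
    card A = card {b :: 'n monom. mdeg b = e - d}}"
  have "holds_for_generic_form e (\<lambda>G :: ('n, 'k) mpoly.
      \<forall>d\<in>{..e}. \<forall>A\<in>?As d. nondegenerate (?K G) A {b. mdeg b = e - d})"
  proof (intro holds_for_generic_form_ball)
    fix d show "finite (?As d)"
      by (rule finite_subset[of _ "Pow {a. mdeg a = d}"]) (auto simp: finite_mdeg_eq)
    fix A assume "d \<in> {..e}" "A \<in> ?As d"
    thus "holds_for_generic_form e (\<lambda>G :: ('n, 'k) mpoly. nondegenerate (?K G) A {b. mdeg b = e - d})"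
      by (intro generic_pairing_nondegenerate[of _ d _ "e - d"]) (auto simp: act_coeff_nonzero)
  qed simp
  thus ?thesis
  proof (rule holds_for_generic_form_mono, intro allI impI)
    fix G :: "('n, 'k) mpoly" and lt :: "'n monom \<Rightarrow> 'n monom \<Rightarrow> bool" and d
    assume G: "G \<in> forms e" "\<forall>d\<in>{..e}. \<forall>A\<in>?As d. nondegenerate (?K G) A {b. mdeg b = e - d}"
      and lt: "monomial_order lt" and d: "real e / 2 \<le> real d \<and> d \<le> e"
    show "initial_ideal lt (Ann G) \<inter> forms d = mpoly.span (monom_poly ` first_monoms lt d
        (mpoly.dim (forms d :: ('n, 'k) mpoly set) - mpoly.dim (forms (e - d) :: ('n, 'k) mpoly set)))"
      \<comment> \<open>The real bound on \<open>d\<close> amounts to \<open>e - d \<le> d\<close>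
        over the natural numbers.\<close>
      unfolding dim_forms by (rule initial_ideal_Ann_degree[OF lt G(1)]) (use G(2) d in auto)
  qed
qed

end
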